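(* Let $\lambda\in\mathbb{R}\setminus\{0\}$, let $r$ be a nonnegative integer and $p$ a nonnegative integer. Then for real $x$ with $|x|<1$, $$\bigg(x\frac{d}{dx}+r\bigg)_{p,\lambda}\frac{1}{1-x}=\sum_{n=0}^{\infty}(n+r)_{p,\lambda}x^{n}=\frac{1}{1-x}F_{p,\lambda}\bigg(\frac{x}{1-x}\bigg|r\bigg).$$ In addition, $$\sum_{n=0}^{\infty}\Big((r)_{p,\lambda}+(1+r)_{p,\lambda}+\cdots+(n+r)_{p,\lambda}\Big)x^{n}=\frac{1}{(1-x)^{2}}F_{p,\lambda}\bigg(\frac{x}{1-x}\bigg|r\bigg).$$
   Context: For $\lambda\neq0$, $(x)_{0,\lambda}=1$ and $(x)_{n,\lambda}=x(x-\lambda)\cdots(x-(n-1)\lambda)$ for $n\ge1$; $e_{\lambda}^{x}(t)=(1+\lambda t)^{x/\lambda}$, $e_\lambda(t)=e_\lambda^1(t)$. The two variable degenerate Fubini polynomials $F_{n,\lambda}(x|r)$ are defined by $\frac{1}{1-x(e_{\lambda}(t)-1)}e_{\lambda}^{r}(t)=\sum_{n=0}^{\infty}F_{n,\lambda}(x|r)\frac{t^{n}}{n!}$. The degenerate differential operator is $\big(x\frac{d}{dx}+r\big)_{p,\lambda}=\big(x\frac{d}{dx}+r\big)\big(x\frac{d}{dx}+r-\lambda\big)\cdots\big(x\frac{d}{dx}+r-(p-1)\lambda\big)$ for $p\ge1$, and the identity operator for $p=0$. *)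

theory Defs
  imports "HOL-Analysis.Analysis"
begin

definition deg_ffact :: "real \<Rightarrow> real \<Rightarrow> nat \<Rightarrow> real" where
  "deg_ffact lam x n = (\<Prod>i<n. x - real i * lam)"

text \<open>
  The degenerate exponential \<open>(1 + lam t)\<close> to the power \<open>x / lam\<close> as a formal power series in
  \<open>t\<close>: the binomial series \<open>(1 + X)\<close> to the power \<open>x / lam\<close>, composed with \<open>lam t\<close>.
\<close>

definition deg_exp :: "real \<Rightarrow> real \<Rightarrow> real fps" where
  "deg_exp lam x = fps_binomial (x / lam) oo (fps_const lam * fps_X)"

definition deg_Fubini_gf :: "real \<Rightarrow> real \<Rightarrow> real \<Rightarrow> real fps" where
  "deg_Fubini_gf lam r x =
     inverse (1 - fps_const x * (deg_exp lam 1 - 1)) * deg_exp lam r"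

text \<open>The value at \<open>x\<close>; the factor \<open>fact n\<close> comes from the exponential generating function.\<close>

definition deg_Fubini :: "real \<Rightarrow> real \<Rightarrow> nat \<Rightarrow> real \<Rightarrow> real" where
  "deg_Fubini lam r n x = fact n * fps_nth (deg_Fubini_gf lam r x) n"

definition theta_shift :: "real \<Rightarrow> (real \<Rightarrow> real) \<Rightarrow> (real \<Rightarrow> real)" where
  "theta_shift a f = (\<lambda>x. x * deriv f x + a * f x)"

text \<open>As in a product of operators, the factor written last, with shift \<open>r - (p - 1) lam\<close>, acts first.\<close>

primrec deg_diff_op :: "real \<Rightarrow> real \<Rightarrow> nat \<Rightarrow> (real \<Rightarrow> real) \<Rightarrow> (real \<Rightarrow> real)" where
  "deg_diff_op lam r 0 f = f"
| "deg_diff_op lam r (Suc p) f = deg_diff_op lam r p (theta_shift (r - real p * lam) f)"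

lemma deg_exp_nth:
  assumes "lam \<noteq> 0"
  shows "fps_nth (deg_exp lam x) n = deg_ffact lam x n / fact n"
proof -
  have "fps_nth (deg_exp lam x) n = lam ^ n * ((x / lam) gchoose n)"
    by (simp add: deg_exp_def fps_compose_linear)
  also have "\<dots> = (\<Prod>i<n. lam * (x / lam - real i)) / fact n"
    by (simp add: gbinomial_prod_rev prod.distrib atLeast0LessThan)
  also have "(\<Prod>i<n. lam * (x / lam - real i)) = deg_ffact lam x n"
    unfolding deg_ffact_def using assms by (intro prod.cong) (auto simp: field_simps)
  finally show ?thesis .
qed

lemma deg_exp_sums:
  assumes "lam \<noteq> 0" "\<bar>lam * t\<bar> < 1"
  shows "(\<lambda>n. fps_nth (deg_exp lam x) n * t ^ n) sums ((1 + lam * t) powr (x / lam))"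
proof -
  have "fps_nth (deg_exp lam x) n * t ^ n = ((x / lam) gchoose n) * (lam * t) ^ n" for n
    by (simp add: deg_exp_def fps_compose_linear power_mult_distrib)
  then show ?thesis
    using gen_binomial_real[of "lam * t" "x / lam"] assms by simp
qed

lemma deg_Fubini_generating_function:
  "Abs_fps (\<lambda>n. deg_Fubini lam r n x / fact n) * (1 - fps_const x * (deg_exp lam 1 - 1)) = deg_exp lam r"
proof -
  define D where "D = 1 - fps_const x * (deg_exp lam 1 - 1)"
  have "fps_nth D 0 \<noteq> 0"
    by (simp add: D_def deg_exp_def)
  then have "inverse D * D = 1"
    by (rule inverse_mult_eq_1)
  then have "(inverse D * deg_exp lam r) * D = deg_exp lam r"
    by (simp add: mult.assoc mult.left_commute mult.commute[of _ D])
  moreover have "Abs_fps (\<lambda>n. deg_Fubini lam r n x / fact n) = inverse D * deg_exp lam r"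
    by (simp add: fps_eq_iff deg_Fubini_def deg_Fubini_gf_def D_def)
  ultimately show ?thesis
    by (simp only: D_def)
qed

end

theory Submission
  imports Defs
begin

text \<open>
  The operator \<open>x d/dx + a\<close> multiplies the coefficient of \<open>x ^ n\<close> by \<open>n + a\<close>, so the first
  identity is termwise differentiation of the geometric series.  For the second, put
  \<open>E = deg_exp lam 1\<close>, so that \<open>E ^ n * deg_exp lam r = deg_exp lam (n + r)\<close>.  The coefficientwise
  sum \<open>G\<close> of \<open>x ^ n * deg_exp lam (n + r)\<close> satisfies \<open>G = deg_exp lam r + x * E * G\<close>, and
  \<open>1 - x * E = (1 - x) * (1 - x / (1 - x) * (E - 1))\<close>; hence \<open>(1 - x) * G\<close> is the Fubini generating
  function at \<open>x / (1 - x)\<close>.  The third identity is the Cauchy product with the geometric series.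
\<close>

lemma theta_shift_sums:
  assumes f: "\<And>y. \<bar>y\<bar> < 1 \<Longrightarrow> (\<lambda>n. c n * y ^ n) sums f y" and x: "\<bar>x\<bar> < 1"
  shows "(\<lambda>n. (real n + a) * c n * x ^ n) sums theta_shift a f x"
proof -
  have sm: "summable (\<lambda>n. c n * y ^ n)" if "norm y < 1" for y
    using f that by (auto intro: sums_summable)
  have "((\<lambda>y. \<Sum>n. c n * y ^ n) has_field_derivative (\<Sum>n. diffs c n * x ^ n)) (at x)"
    using x by (intro termdiffs_strong'[where K = 1] sm) auto
  \<comment> \<open>\<open>f\<close> is only known to equal its power series on the open unit
    interval; this suffices because the derivative at \<open>x\<close> is local.\<close>
  then have "(f has_field_derivative (\<Sum>n. diffs c n * x ^ n)) (at x)"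
    by (rule has_field_derivative_transform_within_open[where S = "{-1<..<1}"])
      (use x f in \<open>auto intro!: sums_unique[symmetric]\<close>)
  then have "deriv f x = (\<Sum>n. diffs c n * x ^ n)"
    by (rule DERIV_imp_deriv)
  moreover have "summable (\<lambda>n. diffs c n * x ^ n)"
    using x by (intro termdiff_converges[where K = 1] sm) auto
  ultimately have "(\<lambda>n. diffs c n * x ^ n) sums deriv f x"
    by (simp add: summable_sums)
  then have "(\<lambda>n. x * (diffs c n * x ^ n)) sums (x * deriv f x)"
    by (rule sums_mult)
  then have "(\<lambda>n. real (Suc n) * c (Suc n) * x ^ Suc n) sums (x * deriv f x)"
    by (simp add: diffs_def mult_ac)
  \<comment> \<open>The restored term at index 0 carries the factor \<open>real 0\<close>, so the
    sum does not change.\<close>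
  then have "(\<lambda>n. real n * c n * x ^ n) sums (x * deriv f x)"
    by (subst (asm) sums_Suc_iff) simp
  from sums_add[OF this sums_mult[OF f[OF x], of a]] show ?thesis
    by (simp add: theta_shift_def algebra_simps)
qed

text \<open>The factor with the largest index acts first, so each induction step replaces
  \<open>f\<close> by its \<open>theta_shift\<close> and \<open>c n\<close> by
  \<open>(n + r - p * lam) * c n\<close>. Hence both are generalized, and the series is required on
  the whole open interval.\<close>

lemma deg_diff_op_sums:
  assumes "\<And>y. \<bar>y\<bar> < 1 \<Longrightarrow> (\<lambda>n. c n * y ^ n) sums f y" and "\<bar>x\<bar> < 1"
  shows "(\<lambda>n. deg_ffact lam (real n + r) p * c n * x ^ n) sums deg_diff_op lam r p f x"
  using assms(1)
proof (induction p arbitrary: c f)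
  case 0
  then show ?case
    using assms(2) by (simp add: deg_ffact_def)
next
  case (Suc p)
  have "(\<lambda>n. deg_ffact lam (real n + r) p * ((real n + (r - real p * lam)) * c n) * x ^ n) sums
      deg_diff_op lam r p (theta_shift (r - real p * lam) f) x"
    by (intro Suc.IH theta_shift_sums Suc.prems)
  then show ?case
    by (simp add: deg_ffact_def mult_ac add_diff_eq)
qed

text \<open>Exponents of binomial series add, and composition with a series without constant term
  respects products.\<close>

lemma deg_exp_add: "deg_exp lam (x + y) = deg_exp lam x * deg_exp lam y"
  by (simp add: deg_exp_def add_divide_distrib fps_binomial_add_mult fps_compose_mult_distrib)

lemma deg_ffact_powser_sums:
  assumes "\<bar>x\<bar> < 1"
  shows "(\<lambda>n. deg_ffact lam (real n + r) p * x ^ n) sums deg_diff_op lam r p (\<lambda>y. 1 / (1 - y)) x"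
proof -
  have "(\<lambda>n. 1 * y ^ n) sums (1 / (1 - y))" if "\<bar>y\<bar> < 1" for y :: real
    using geometric_sums[of y] that by simp
  from deg_diff_op_sums[OF this assms, of lam r p] show ?thesis
    by simp
qed

lemma deg_ffact_powser_sums_deg_Fubini:
  assumes "lam \<noteq> 0" and x: "\<bar>x\<bar> < 1"
  shows "(\<lambda>n. deg_ffact lam (real n + r) p * x ^ n) sums
    (1 / (1 - x) * deg_Fubini lam r p (x / (1 - x)))"
proof -
  define e where "e n = fps_nth (deg_exp lam (real n + r))" for n
  define G where "G = Abs_fps (\<lambda>k. \<Sum>n. e n k * x ^ n)"
  define D where "D = 1 - fps_const (x / (1 - x)) * (deg_exp lam 1 - 1)"
  have e: "e n k = deg_ffact lam (real n + r) k / fact k" for n k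
    using assms by (simp add: e_def deg_exp_nth)
  \<comment> \<open>Up to the factor \<open>fact k\<close>, this is the series of the first identity
    with \<open>k\<close> in place of \<open>p\<close>, so its convergence is already known.\<close>
  have G: "(\<lambda>n. e n k * x ^ n) sums fps_nth G k" for k
    using summable_divide[OF sums_summable[OF deg_ffact_powser_sums[OF x, of lam r k]], of "fact k"]
    by (simp add: G_def e summable_sums)
  have e_Suc: "e (Suc n) k = (\<Sum>i=0..k. fps_nth (deg_exp lam 1) i * e n (k - i))" for n k
    using deg_exp_add[of lam 1 "real n + r"] by (simp add: e_def fps_mult_nth add_ac)
  \<comment> \<open>The term at \<open>n = 0\<close> is split off and \<open>e_Suc\<close> rewrites
    the rest. Each coefficient of the product involves only finitely many \<open>i\<close>, so the
    sums over \<open>i\<close> and \<open>n\<close> may be exchanged.\<close>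
  have rec: "G = deg_exp lam r + fps_const x * (deg_exp lam 1 * G)"
  proof (rule fps_ext)
    fix k
    have "(\<lambda>n. x * (\<Sum>i=0..k. fps_nth (deg_exp lam 1) i * (e n (k - i) * x ^ n))) sums
        (x * (\<Sum>i=0..k. fps_nth (deg_exp lam 1) i * fps_nth G (k - i)))"
      by (intro sums_mult sums_sum G)
    then have "(\<lambda>n. e (Suc n) k * x ^ Suc n) sums (x * fps_nth (deg_exp lam 1 * G) k)"
      unfolding fps_mult_nth by (simp add: e_Suc sum_distrib_left sum_distrib_right mult_ac)
    then have "(\<lambda>n. e n k * x ^ n) sums (x * fps_nth (deg_exp lam 1 * G) k + e 0 k)"
      by (subst (asm) sums_Suc_iff) simp
    with G have "fps_nth G k = x * fps_nth (deg_exp lam 1 * G) k + e 0 k"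
      by (rule sums_unique2)
    then show "fps_nth G k = fps_nth (deg_exp lam r + fps_const x * (deg_exp lam 1 * G)) k"
      by (simp add: e_def)
  qed
  have fac: "fps_const (1 - x) * D = 1 - fps_const x * deg_exp lam 1"
  proof -
    have "fps_const (1 - x) * D =
        fps_const (1 - x) - fps_const (1 - x) * fps_const (x / (1 - x)) * (deg_exp lam 1 - 1)"
      by (simp only: D_def right_diff_distrib mult_1_right mult.assoc)
    also have "fps_const (1 - x) * fps_const (x / (1 - x)) = fps_const x"
      using x by simp
    finally show ?thesis
      by (simp add: algebra_simps flip: fps_const_sub)
  qed
  have "D * (fps_const (1 - x) * G) = (fps_const (1 - x) * D) * G"
    by (simp only: mult_ac)
  also have "\<dots> = G - fps_const x * (deg_exp lam 1 * G)"
    unfolding fac by (simp only: left_diff_distrib mult_1_left mult.assoc)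
  also have "\<dots> = deg_exp lam r"
    using rec by (simp only: diff_eq_eq)
  finally have "D * (fps_const (1 - x) * G) = deg_exp lam r" .
  \<comment> \<open>\<open>D\<close> has constant term 1, because \<open>deg_exp lam 1\<close>
    does.\<close>
  moreover have "inverse D * D = 1"
    by (rule inverse_mult_eq_1) (simp add: D_def deg_exp_def)
  ultimately have "fps_const (1 - x) * G = deg_Fubini_gf lam r (x / (1 - x))"
    unfolding deg_Fubini_gf_def D_def[symmetric] by (metis mult.assoc mult_1)
  then have "fps_nth (deg_Fubini_gf lam r (x / (1 - x))) p = (1 - x) * fps_nth G p"
    by (metis fps_mult_left_const_nth)
  then have "fact p * fps_nth G p = 1 / (1 - x) * deg_Fubini lam r p (x / (1 - x))"
    using x by (simp add: deg_Fubini_def)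
  with sums_mult[OF G[of p], of "fact p"] show ?thesis
    by (simp add: e)
qed

text \<open>Multiplication by the geometric series turns coefficients into their partial sums. The
  Cauchy product needs absolute convergence at \<open>x\<close>, which follows from convergence at a
  point \<open>z\<close> strictly between \<open>\<bar>x\<bar>\<close> and 1.\<close>

lemma partial_sums_powser_sums:
  fixes c :: "nat \<Rightarrow> real"
  assumes c: "\<And>y. \<bar>y\<bar> < 1 \<Longrightarrow> summable (\<lambda>n. c n * y ^ n)" and x: "\<bar>x\<bar> < 1"
    and s: "(\<lambda>n. c n * x ^ n) sums s"
  shows "(\<lambda>n. (\<Sum>k=0..n. c k) * x ^ n) sums (1 / (1 - x) * s)"
proof -
  obtain z where "\<bar>x\<bar> < z" "z < 1"
    using x dense by blast
  then have "summable (\<lambda>n. norm (c n * x ^ n))"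
    using powser_insidea[of c z x] c[of z] by auto
  moreover have "summable (\<lambda>n. norm (x ^ n))"
    using x summable_geometric[of "\<bar>x\<bar>"] by (simp add: power_abs)
  ultimately have "(\<lambda>n. \<Sum>k\<le>n. c k * x ^ k * x ^ (n - k)) sums
      ((\<Sum>n. c n * x ^ n) * (\<Sum>n. x ^ n))"
    by (rule Cauchy_product_sums)
  moreover have "(\<Sum>k\<le>n. c k * x ^ k * x ^ (n - k)) = (\<Sum>k=0..n. c k) * x ^ n" for n
    unfolding sum_distrib_right
    by (intro sum.cong) (auto simp: mult.assoc atLeast0AtMost simp flip: power_add)
  ultimately show ?thesis
    using x sums_unique[OF s] by (simp add: suminf_geometric)
qed

theorem theorem6:
  fixes lam x :: real and r p :: nat
  assumes "lam \<noteq> 0" and "\<bar>x\<bar> < 1"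
  shows "((\<lambda>n. deg_ffact lam (real (n + r)) p * x ^ n) sums
           deg_diff_op lam (real r) p (\<lambda>y. 1 / (1 - y)) x) \<and>
         ((\<lambda>n. deg_ffact lam (real (n + r)) p * x ^ n) sums
           (1 / (1 - x) * deg_Fubini lam (real r) p (x / (1 - x)))) \<and>
         ((\<lambda>n. (\<Sum>k=0..n. deg_ffact lam (real (k + r)) p) * x ^ n) sums
           (1 / (1 - x) ^ 2 * deg_Fubini lam (real r) p (x / (1 - x))))"
proof (intro conjI)
  show "(\<lambda>n. deg_ffact lam (real (n + r)) p * x ^ n) sums
      deg_diff_op lam (real r) p (\<lambda>y. 1 / (1 - y)) x"
    using deg_ffact_powser_sums[OF assms(2)] by simp
  show *: "(\<lambda>n. deg_ffact lam (real (n + r)) p * x ^ n) sums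
      (1 / (1 - x) * deg_Fubini lam (real r) p (x / (1 - x)))"
    using deg_ffact_powser_sums_deg_Fubini[OF assms] by simp
  \<comment> \<open>The first identity gives summability on the whole open interval, the second the
    value at \<open>x\<close>.\<close>
  have "(\<lambda>n. (\<Sum>k=0..n. deg_ffact lam (real (k + r)) p) * x ^ n) sums
      (1 / (1 - x) * (1 / (1 - x) * deg_Fubini lam (real r) p (x / (1 - x))))"
    using deg_ffact_powser_sums[of _ lam "real r" p] * assms(2)
    by (intro partial_sums_powser_sums) (auto intro: sums_summable)
  then show "(\<lambda>n. (\<Sum>k=0..n. deg_ffact lam (real (k + r)) p) * x ^ n) sums
      (1 / (1 - x) ^ 2 * deg_Fubini lam (real r) p (x / (1 - x)))"
    by (simp add: power2_eq_square)
qed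

end
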